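(* Every graphic matroid has property (P+): for any pair $A,B$ of bases of the matroid, there exists a path with vertex set $A\triangle B$ that alternates between $A\setminus B$ and $B\setminus A$ and covers $\mathcal{C}[A\cup B]$.
   Context: For a matroid with circuit set $\mathcal{C}$ and a subset $X$ of the ground set, $\mathcal{C}[X]$ is the set of circuits contained in $X$. A graph (here a path) whose vertex set is a set of matroid elements covers a family of circuits if every circuit in the family contains both endpoints of some edge of the graph; equivalently, for every stable set $S$ of the path, $(A\cap B)\cup S$ is independent. *)

theory Defs
  imports Main
begin

locale matroid =
  fixes carrier :: "'a set" and indep :: "'a set \<Rightarrow> bool"
  assumes finite_carrier: "finite carrier"
    and indep_subset_carrier: "indep X \<Longrightarrow> X \<subseteq> carrier"
    and indep_empty: "indep {}"
    and indep_mono: "indep X \<Longrightarrow> Y \<subseteq> X \<Longrightarrow> indep Y"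
    and augment: "indep X \<Longrightarrow> indep Y \<Longrightarrow> card Y < card X \<Longrightarrow> \<exists>x\<in>X - Y. indep (insert x Y)"

definition basis :: "'a set \<Rightarrow> ('a set \<Rightarrow> bool) \<Rightarrow> 'a set \<Rightarrow> bool" where
  "basis E indep A \<longleftrightarrow> A \<subseteq> E \<and> indep A \<and> (\<forall>Y. A \<subset> Y \<and> Y \<subseteq> E \<longrightarrow> \<not> indep Y)"

definition circuits_in :: "'a set \<Rightarrow> ('a set \<Rightarrow> bool) \<Rightarrow> 'a set \<Rightarrow> 'a set set" where
  "circuits_in E indep X =
     {C. C \<subseteq> E \<and> \<not> indep C \<and> (\<forall>D. D \<subset> C \<longrightarrow> indep D) \<and> C \<subseteq> X}"

definition matroid_isomorphic ::
    "'a set \<Rightarrow> ('a set \<Rightarrow> bool) \<Rightarrow> 'b set \<Rightarrow> ('b set \<Rightarrow> bool) \<Rightarrow> bool" where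
  "matroid_isomorphic E indep E' indep' \<longleftrightarrow>
     (\<exists>f. bij_betw f E E' \<and> (\<forall>X\<subseteq>E. indep X \<longleftrightarrow> indep' (f ` X)))"

text \<open>Finite undirected graphs, with loops (one end) and parallel edges allowed.\<close>

locale finite_multigraph =
  fixes verts :: "'v set" and edges :: "'e set" and ends :: "'e \<Rightarrow> 'v set"
  assumes finite_verts: "finite verts"
    and finite_edges: "finite edges"
    and ends_subset: "e \<in> edges \<Longrightarrow> ends e \<subseteq> verts"
    and card_ends: "e \<in> edges \<Longrightarrow> card (ends e) \<in> {1, 2}"

text \<open>The cyclic sequence \<open>vs ! 0, es ! 0, vs ! 1, es ! 1, \<dots>\<close> closes up at \<open>vs ! 0\<close>. A loop is a
  cycle of length 1 and a pair of parallel edges is a cycle of length 2; it is distinctness of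
  \<open>es\<close> that prevents a single edge from being traversed back and forth.\<close>

definition is_cycle :: "'v set \<Rightarrow> 'e set \<Rightarrow> ('e \<Rightarrow> 'v set) \<Rightarrow> 'v list \<Rightarrow> 'e list \<Rightarrow> bool" where
  "is_cycle V F ends vs es \<longleftrightarrow>
     es \<noteq> [] \<and> length vs = length es \<and> distinct vs \<and> distinct es \<and>
     set vs \<subseteq> V \<and> set es \<subseteq> F \<and>
     (\<forall>i<length es. ends (es ! i) = {vs ! i, vs ! (Suc i mod length es)})"

definition cycle_matroid_indep :: "'v set \<Rightarrow> 'e set \<Rightarrow> ('e \<Rightarrow> 'v set) \<Rightarrow> 'e set \<Rightarrow> bool" where
  "cycle_matroid_indep V F ends X \<longleftrightarrow>
     X \<subseteq> F \<and> \<not> (\<exists>vs es. is_cycle V F ends vs es \<and> set es \<subseteq> X)"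

text \<open>A matroid is graphic iff it is isomorphic to the cycle matroid of some finite multigraph. The
  graph is an explicit argument because a definition cannot quantify over the types of its
  vertices and edges.\<close>

definition graphic_matroid_via ::
    "'a set \<Rightarrow> ('a set \<Rightarrow> bool) \<Rightarrow> 'v set \<Rightarrow> 'e set \<Rightarrow> ('e \<Rightarrow> 'v set) \<Rightarrow> bool" where
  "graphic_matroid_via E indep V F ends \<longleftrightarrow>
     matroid E indep \<and> finite_multigraph V F ends \<and>
     matroid_isomorphic E indep F (cycle_matroid_indep V F ends)"

text \<open>A path is given by the list of its vertices in order; the empty list is the path with empty
  vertex set, needed when the two bases coincide.\<close>

definition path_on :: "'a set \<Rightarrow> 'a list \<Rightarrow> bool" where
  "path_on X p \<longleftrightarrow> distinct p \<and> set p = X"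

definition path_edges :: "'a list \<Rightarrow> 'a set set" where
  "path_edges p = {{p ! i, p ! Suc i} | i. Suc i < length p}"

definition alternates :: "'a set \<Rightarrow> 'a set \<Rightarrow> 'a list \<Rightarrow> bool" where
  "alternates X Y p \<longleftrightarrow>
     (\<forall>i. Suc i < length p \<longrightarrow>
        p ! i \<in> X \<and> p ! Suc i \<in> Y \<or> p ! i \<in> Y \<and> p ! Suc i \<in> X)"

definition covers :: "'a set set \<Rightarrow> 'a set set \<Rightarrow> bool" where
  "covers G \<C> \<longleftrightarrow> (\<forall>C\<in>\<C>. \<exists>e\<in>G. e \<subseteq> C)"

definition property_P_plus :: "'a set \<Rightarrow> ('a set \<Rightarrow> bool) \<Rightarrow> bool" where
  "property_P_plus E indep \<longleftrightarrow>
     (\<forall>A B. basis E indep A \<and> basis E indep B \<longrightarrow>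
        (\<exists>p. path_on (sym_diff A B) p \<and> alternates (A - B) (B - A) p \<and>
             covers (path_edges p) (circuits_in E indep (A \<union> B))))"

end

theory Submission imports Defs begin

text \<open>Two spanning forests \<open>A\<close>, \<open>B\<close> of the same graph have total degree less than four times the
  number of vertices, counting common edges twice, so some vertex \<open>v\<close> has degrees (1,1), (2,1) or
  (1,2) in \<open>A\<close> and \<open>B\<close>. In the first case delete \<open>v\<close> with its edges \<open>a\<close> and \<open>b\<close>, apply induction,
  and append \<open>a\<close>, \<open>b\<close> in the suitable order: a cycle through \<open>v\<close> uses both. In the second case
  (the third is symmetric) let \<open>a\<close>, \<open>c\<close> be the edges of \<open>A\<close> at \<open>v\<close> and \<open>b\<close> that of \<open>B\<close>; delete \<open>b\<close>,
  merge \<open>a\<close>, \<open>c\<close> into a single edge joining their other ends, apply induction, and replace the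
  merged edge in the path by \<open>a, b, c\<close> (by \<open>a\<close> alone if \<open>b = c\<close>). A cycle through \<open>v\<close> that
  avoids \<open>b\<close> uses \<open>a\<close> and \<open>c\<close>, hence comes from a cycle through the merged edge, and the covering
  pair survives because the path enters the new segment at \<open>a\<close> and leaves it at \<open>c\<close>.

  Acyclicity and equality of spans are handled linearly over the field with two elements, by
  means of the set \<open>bd g D\<close> of vertices of odd degree in an edge set \<open>D\<close>.\<close>

section \<open>Boundaries of edge sets\<close>

text \<open>A loop contributes its single end, so this is the usual boundary modulo 2 only for edges
  with two ends; hence the recurring hypothesis \<open>card (g e) = 2\<close>.\<close>

definition bd :: "('e \<Rightarrow> 'v set) \<Rightarrow> 'e set \<Rightarrow> 'v set" where
  "bd g D = {v. odd (card {e\<in>D. v \<in> g e})}"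

lemma odd_card_sym_diff:
  assumes "finite S" "finite T"
  shows "odd (card (sym_diff S T)) \<longleftrightarrow> odd (card S) \<noteq> odd (card T)"
proof -
  have "card S = card (S - T) + card (S \<inter> T)"
    using assms card_Diff_subset_Int[of S T] card_mono[of S "S \<inter> T"] by simp
  moreover have "card T = card (T - S) + card (S \<inter> T)"
    using assms card_Diff_subset_Int[of T S] card_mono[of T "S \<inter> T"] by (simp add: Int_commute)
  moreover have "card (sym_diff S T) = card (S - T) + card (T - S)"
    using assms by (intro card_Un_disjoint) auto
  ultimately show ?thesis by presburger
qed

lemma bd_empty [simp]: "bd g {} = {}"
  by (simp add: bd_def)

lemma bd_cong: "(\<And>e. e \<in> D \<Longrightarrow> g e = h e) \<Longrightarrow> bd g D = bd h D"
  unfolding bd_def by (metis (mono_tags, lifting) Collect_cong)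

text \<open>Linearity of the boundary: symmetric difference is addition over the field with two
  elements.\<close>

lemma bd_sym_diff:
  assumes "finite C" "finite D"
  shows "bd g (sym_diff C D) = sym_diff (bd g C) (bd g D)"
proof -
  have "{e \<in> sym_diff C D. v \<in> g e} = sym_diff {e\<in>C. v \<in> g e} {e\<in>D. v \<in> g e}" for v
    by auto
  then have "odd (card {e \<in> sym_diff C D. v \<in> g e}) \<longleftrightarrow>
      odd (card {e\<in>C. v \<in> g e}) \<noteq> odd (card {e\<in>D. v \<in> g e})" for v
    using odd_card_sym_diff[of "{e\<in>C. v \<in> g e}" "{e\<in>D. v \<in> g e}"] assms by simp
  then show ?thesis unfolding bd_def by auto
qed

lemma bd_singleton [simp]: "bd g {e} = g e"
proof -
  have "{x \<in> {e}. v \<in> g x} = (if v \<in> g e then {e} else {})" for v by auto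
  then show ?thesis unfolding bd_def by auto
qed

lemma bd_insert:
  assumes "finite D" "e \<notin> D"
  shows "bd g (insert e D) = sym_diff (bd g D) (g e)"
proof -
  have "insert e D = sym_diff D {e}" using assms by auto
  then show ?thesis using bd_sym_diff[of D "{e}" g] assms by simp
qed

lemma bd_subset: "bd g D \<subseteq> \<Union> (g ` D)"
proof
  fix v assume "v \<in> bd g D"
  then have "{e\<in>D. v \<in> g e} \<noteq> {}" unfolding bd_def using card.empty by fastforce
  then show "v \<in> \<Union> (g ` D)" by auto
qed

text \<open>Handshake lemma: adding an edge flips the parity at exactly two vertices.\<close>

lemma even_card_bd:
  assumes "finite D" "\<And>e. e \<in> D \<Longrightarrow> card (g e) = 2"
  shows "finite (bd g D) \<and> even (card (bd g D))"
  using assms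
proof (induction D)
  case empty
  then show ?case by simp
next
  case (insert e D)
  have "finite (g e)" using insert.prems[of e] by (metis card.infinite insertI1 zero_neq_numeral)
  then show ?case
    using insert odd_card_sym_diff[of "bd g D" "g e"] bd_insert[of D e g] by simp
qed

text \<open>Injectivity of the boundary on subsets of \<open>A\<close> is linear independence over the field with
  two elements, that is, acyclicity.\<close>

lemma inj_on_bd_iff:
  assumes "finite A"
  shows "inj_on (bd g) (Pow A) \<longleftrightarrow> (\<forall>D\<subseteq>A. bd g D = {} \<longrightarrow> D = {})"
proof
  assume inj: "inj_on (bd g) (Pow A)"
  show "\<forall>D\<subseteq>A. bd g D = {} \<longrightarrow> D = {}"
    using inj_onD[OF inj, of _ "{}"] by simp
next
  assume R: "\<forall>D\<subseteq>A. bd g D = {} \<longrightarrow> D = {}"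
  show "inj_on (bd g) (Pow A)"
  proof (rule inj_onI)
    fix C D assume CD: "C \<in> Pow A" "D \<in> Pow A" "bd g C = bd g D"
    then have fin: "finite C" "finite D" using assms finite_subset by auto
    have "bd g (sym_diff C D) = {}" using bd_sym_diff[OF fin, of g] CD by simp
    moreover have "sym_diff C D \<subseteq> A" using CD by auto
    ultimately have "sym_diff C D = {}" using R by blast
    then show "C = D" by auto
  qed
qed

text \<open>The bound on the number of edges of a forest. Boundaries have even size and so are never
  a singleton \<open>{t}\<close>; injectivity then embeds \<open>Pow A\<close> into a proper part of
  \<open>Pow T\<close>, and powers of two are compared.\<close>

lemma card_less_of_inj_bd:
  assumes "finite T" "finite A" "T \<noteq> {}" "\<And>e. e \<in> A \<Longrightarrow> card (g e) = 2"
    and "\<And>e. e \<in> A \<Longrightarrow> g e \<subseteq> T" and inj: "inj_on (bd g) (Pow A)"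
  shows "card A < card T"
proof -
  obtain t where t: "t \<in> T" using assms by auto
  have "bd g D \<in> Pow T - {{t}}" if "D \<subseteq> A" for D
  proof -
    have "even (card (bd g D))" using even_card_bd[of D g] that assms finite_subset by blast
    moreover have "bd g D \<subseteq> T" using bd_subset[of g D] that assms(5) by blast
    ultimately show ?thesis by auto
  qed
  then have "bd g ` Pow A \<subseteq> Pow T - {{t}}" by auto
  also have "\<dots> \<subset> Pow T" using t by auto
  finally have "card (bd g ` Pow A) < card (Pow T)" using assms(1) by (intro psubset_card_mono) auto
  then have "(2::nat) ^ card A < 2 ^ card T" using card_image[OF inj] assms by (simp add: card_Pow)
  then show ?thesis by simp
qed

section \<open>Parity at a vertex of degree one, two or three\<close>

lemma mem_bd_iff_unique:
  assumes "{e\<in>A. v \<in> g e} = {a}" "D \<subseteq> A"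
  shows "v \<in> bd g D \<longleftrightarrow> a \<in> D"
proof -
  have "{e\<in>D. v \<in> g e} = (if a \<in> D then {a} else {})" using assms by auto
  then show ?thesis unfolding bd_def by simp
qed

lemma mem_bd_iff_two:
  assumes "{e\<in>A. v \<in> g e} = {a, b}" "a \<noteq> b" "D \<subseteq> A"
  shows "v \<in> bd g D \<longleftrightarrow> (a \<in> D) \<noteq> (b \<in> D)"
proof -
  have "{e\<in>D. v \<in> g e} = {a, b} \<inter> D" using assms by auto
  then have "v \<in> bd g D \<longleftrightarrow> odd (card ({a, b} \<inter> D))" unfolding bd_def by simp
  then show ?thesis using assms(2) by (cases "a \<in> D"; cases "b \<in> D") auto
qed

lemma mem_bd_iff_three:
  assumes "{e\<in>A. v \<in> g e} = {a, b, c}" "distinct [a, b, c]" "D \<subseteq> A"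
  shows "v \<in> bd g D \<longleftrightarrow> ((a \<in> D) \<noteq> (b \<in> D)) \<noteq> (c \<in> D)"
proof -
  have "{e\<in>D. v \<in> g e} = {a, b, c} \<inter> D" using assms by auto
  then have "v \<in> bd g D \<longleftrightarrow> odd (card ({a, b, c} \<inter> D))" unfolding bd_def by simp
  then show ?thesis using assms(2)
    by (cases "a \<in> D"; cases "b \<in> D"; cases "c \<in> D") auto
qed

text \<open>The right-hand side depends on \<open>A\<close> only through its span, so two forests
  with equal spans still have equal spans after each loses its only edge at
  \<open>v\<close>.\<close>

lemma bd_image_remove_unique:
  assumes "{e\<in>A. v \<in> g e} = {a}"
  shows "bd g ` Pow (A - {a}) = {X \<in> bd g ` Pow A. v \<notin> X}"
proof -
  have "Pow (A - {a}) = {D \<in> Pow A. v \<notin> bd g D}"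
    using mem_bd_iff_unique[OF assms] by blast
  then show ?thesis by auto
qed

text \<open>The vertices met by an edge set can be read off its span; forests with equal spans
  therefore meet the same vertices.\<close>

lemma bd_image_touch:
  assumes "finite A"
  shows "(\<exists>X \<in> bd g ` Pow A. v \<in> X) \<longleftrightarrow> {e\<in>A. v \<in> g e} \<noteq> {}"
proof
  assume "\<exists>X \<in> bd g ` Pow A. v \<in> X"
  then show "{e\<in>A. v \<in> g e} \<noteq> {}" using bd_subset[of g] by blast
next
  assume "{e\<in>A. v \<in> g e} \<noteq> {}"
  then obtain e where "e \<in> A" "v \<in> g e" by auto
  then show "\<exists>X \<in> bd g ` Pow A. v \<in> X" using bd_singleton[of g e]
    by (metis (no_types, lifting) Pow_iff empty_subsetI image_eqI insert_subset)
qed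

text \<open>The merged edge keeps the name \<open>a\<close> and stands for \<open>a\<close> and
  \<open>c\<close> together: the common end cancels in the sum of the two end sets.\<close>

lemma bd_fun_upd_sum:
  assumes "finite D" "a \<noteq> c" "c \<notin> D"
  shows "bd (g(a := sym_diff (g a) (g c))) D = (if a \<in> D then bd g (insert c D) else bd g D)"
proof (cases "a \<in> D")
  case True
  define E where "E = D - {a}"
  have D: "D = insert a E" "a \<notin> E" "finite E" "c \<notin> E" using True assms E_def by auto
  let ?h = "g(a := sym_diff (g a) (g c))"
  have "bd ?h D = sym_diff (bd ?h E) (?h a)" using bd_insert D by metis
  also have "bd ?h E = bd g E" using D by (intro bd_cong) auto
  finally have 1: "bd ?h D = sym_diff (bd g E) (sym_diff (g a) (g c))"
    unfolding fun_upd_same .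
  have "bd g (insert c D) = sym_diff (sym_diff (bd g E) (g a)) (g c)"
    using bd_insert[of E a g] bd_insert[of D c g] D assms by simp
  with 1 True show ?thesis by auto
next
  case False
  then have "bd (g(a := sym_diff (g a) (g c))) D = bd g D" by (intro bd_cong) auto
  with False show ?thesis by simp
qed

section \<open>Covering even edge sets by an alternating path\<close>

definition alt_rel :: "'e set \<Rightarrow> 'e set \<Rightarrow> 'e \<Rightarrow> 'e \<Rightarrow> bool" where
  "alt_rel X Y x y \<longleftrightarrow> x \<in> X \<and> y \<in> Y \<or> x \<in> Y \<and> y \<in> X"

text \<open>Covering is required for all nonempty even sets, not only for cycles, because evenness
  is easy to follow through deletion and merging. The last clause says that two consecutive path
  elements lie in \<open>D\<close>.\<close>

definition alt_cover_path :: "('e \<Rightarrow> 'v set) \<Rightarrow> 'e set \<Rightarrow> 'e set \<Rightarrow> 'e list \<Rightarrow> bool" where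
  "alt_cover_path g A B p \<longleftrightarrow>
     distinct p \<and> set p = sym_diff A B \<and> successively (alt_rel (A - B) (B - A)) p \<and>
     (\<forall>D\<subseteq>A \<union> B. D \<noteq> {} \<and> bd g D = {} \<longrightarrow> \<not> successively (\<lambda>x y. \<not> (x \<in> D \<and> y \<in> D)) p)"

text \<open>\<open>A\<close> and \<open>B\<close> are loopless bases of the same space of
  boundaries. No ambient graph is fixed, so the end map may change during the induction.\<close>

definition equivalent_forests :: "('e \<Rightarrow> 'v set) \<Rightarrow> 'e set \<Rightarrow> 'e set \<Rightarrow> bool" where
  "equivalent_forests g A B \<longleftrightarrow>
     finite A \<and> finite B \<and> (\<forall>e\<in>A \<union> B. card (g e) = 2) \<and>
     inj_on (bd g) (Pow A) \<and> inj_on (bd g) (Pow B) \<and> bd g ` Pow A = bd g ` Pow B"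

lemma equivalent_forests_commute: "equivalent_forests g A B \<Longrightarrow> equivalent_forests g B A"
  unfolding equivalent_forests_def by auto

lemma alt_cover_path_commute: "alt_cover_path g A B p \<Longrightarrow> alt_cover_path g B A p"
proof -
  have "alt_rel (A - B) (B - A) = alt_rel (B - A) (A - B)" unfolding alt_rel_def by blast
  then show "alt_cover_path g A B p \<Longrightarrow> alt_cover_path g B A p"
    unfolding alt_cover_path_def by (simp add: Un_commute)
qed

lemma low_degree_vertex:
  assumes ef: "equivalent_forests g A B" and "A \<noteq> {}"
  obtains v where "{e\<in>A. v \<in> g e} \<noteq> {}" "{e\<in>B. v \<in> g e} \<noteq> {}"
    "card {e\<in>A. v \<in> g e} + card {e\<in>B. v \<in> g e} \<le> 3"
proof -
  have fin: "finite A" "finite B" and two: "\<And>e. e \<in> A \<union> B \<Longrightarrow> card (g e) = 2"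
    and injA: "inj_on (bd g) (Pow A)" and injB: "inj_on (bd g) (Pow B)"
    and span: "bd g ` Pow A = bd g ` Pow B"
    using ef unfolding equivalent_forests_def by auto
  define T where "T = \<Union> (g ` (A \<union> B))"
  have fing: "finite (g e)" if "e \<in> A \<union> B" for e
    using two[OF that] by (metis card.infinite zero_neq_numeral)
  have finT: "finite T" unfolding T_def using fin fing by auto
  obtain a where a: "a \<in> A" using assms by auto
  then have "g a \<noteq> {}" using two[of a] by auto
  then have Tne: "T \<noteq> {}" using a unfolding T_def by auto
  have sub: "g e \<subseteq> T" if "e \<in> A \<union> B" for e using that T_def by auto
  \<comment> \<open>Both power sets are in bijection with the common span.\<close>
  have "card (Pow A) = card (Pow B)" using card_image[OF injA] card_image[OF injB] span by simp
  then have cAB: "card A = card B" using fin by (simp add: card_Pow)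
  have lt: "card A < card T"
    by (rule card_less_of_inj_bd[OF finT fin(1) Tne _ _ injA]) (use two sub in auto)
  \<comment> \<open>Double counting of incidences: every edge has two ends, both in
    \<open>T\<close>.\<close>
  have dc: "(\<Sum>v\<in>T. card {e\<in>X. v \<in> g e}) = 2 * card X" if "X \<subseteq> A \<union> B" for X
  proof (rule sum_multicount)
    show "finite T" by fact
    show "finite X" using that fin finite_subset by blast
    show "\<forall>e\<in>X. card {v\<in>T. v \<in> g e} = 2"
    proof
      fix e assume "e \<in> X"
      then have "{v\<in>T. v \<in> g e} = g e" "card (g e) = 2" using sub two that by auto
      then show "card {v\<in>T. v \<in> g e} = 2" by simp
    qed
  qed
  have "\<exists>v\<in>T. card {e\<in>A. v \<in> g e} + card {e\<in>B. v \<in> g e} \<le> 3"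
  proof (rule ccontr)
    assume "\<not> ?thesis"
    then have "\<And>v. v \<in> T \<Longrightarrow> 4 \<le> card {e\<in>A. v \<in> g e} + card {e\<in>B. v \<in> g e}"
      by fastforce
    then have "card T * 4 \<le> (\<Sum>v\<in>T. card {e\<in>A. v \<in> g e} + card {e\<in>B. v \<in> g e})"
      using sum_bounded_below[of T "4::nat"] by simp
    also have "\<dots> = 2 * card A + 2 * card B"
      using dc[of A] dc[of B] by (simp add: sum.distrib)
    finally show False using cAB lt by simp
  qed
  then obtain v where v: "v \<in> T" "card {e\<in>A. v \<in> g e} + card {e\<in>B. v \<in> g e} \<le> 3" by blast
  \<comment> \<open>The degree bound alone would also allow one of the degrees to be zero; equality
    of spans excludes this.\<close>
  have iff: "{e\<in>A. v \<in> g e} \<noteq> {} \<longleftrightarrow> {e\<in>B. v \<in> g e} \<noteq> {}"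
    using bd_image_touch[OF fin(1), of g v] bd_image_touch[OF fin(2), of g v] span by simp
  have "{e\<in>A. v \<in> g e} \<noteq> {} \<or> {e\<in>B. v \<in> g e} \<noteq> {}" using v(1) unfolding T_def by blast
  with iff v that show thesis by blast
qed

lemma equivalent_forests_remove_leaf:
  assumes ef: "equivalent_forests g A B"
    and a: "{e\<in>A. v \<in> g e} = {a}" and b: "{e\<in>B. v \<in> g e} = {b}"
  shows "equivalent_forests g (A - {a}) (B - {b})"
proof -
  have "inj_on (bd g) (Pow (A - {a}))" "inj_on (bd g) (Pow (B - {b}))"
    using ef inj_on_subset[of "bd g" "Pow A" "Pow (A - {a})"]
      inj_on_subset[of "bd g" "Pow B" "Pow (B - {b})"]
    unfolding equivalent_forests_def by auto
  then show ?thesis using ef bd_image_remove_unique[OF a] bd_image_remove_unique[OF b]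
    unfolding equivalent_forests_def by auto
qed

lemma alt_cover_path_add_leaf:
  assumes p: "alt_cover_path g (A - {a}) (B - {b}) p"
    and a: "{e\<in>A. v \<in> g e} = {a}" and b: "{e\<in>B. v \<in> g e} = {b}"
  shows "\<exists>q. alt_cover_path g A B q"
proof (cases "a = b")
  case True
  \<comment> \<open>A common edge that is the only one at \<open>v\<close> lies in no even set, so
    \<open>p\<close> itself serves.\<close>
  have u: "{e \<in> A \<union> B. v \<in> g e} = {a}" using a b True by blast
  have ab: "a \<in> A" "a \<in> B" using a b True by auto
  have D: "D \<subseteq> (A - {a}) \<union> (B - {b})" if "D \<subseteq> A \<union> B" "bd g D = {}" for D
    using mem_bd_iff_unique[OF u that(1)] that True by auto
  have s: "(A - {a}) - (B - {b}) = A - B" "(B - {b}) - (A - {a}) = B - A" using ab True by auto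
  have "distinct p" "set p = sym_diff A B" "successively (alt_rel (A - B) (B - A)) p"
    using p unfolding alt_cover_path_def s by simp_all
  moreover have "\<not> successively (\<lambda>x y. \<not> (x \<in> C \<and> y \<in> C)) p"
    if "C \<subseteq> A \<union> B" "C \<noteq> {}" "bd g C = {}" for C
    using p D[OF that(1,3)] that unfolding alt_cover_path_def by simp
  ultimately have "alt_cover_path g A B p" unfolding alt_cover_path_def by simp
  then show ?thesis by blast
next
  case False
  have ab: "a \<in> A" "b \<in> B" "a \<notin> B" "b \<notin> A" using a b False by auto
  have u: "{e \<in> A \<union> B. v \<in> g e} = {a, b}" using a b by blast
  have s: "(A - {a}) - (B - {b}) = A - B - {a}" "(B - {b}) - (A - {a}) = B - A - {b}"
    using ab by auto
  \<comment> \<open>The order of the new edges is forced by the side of the last element of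
    \<open>p\<close>; for empty \<open>p\<close> either order would do.\<close>
  define q where "q = (if p \<noteq> [] \<and> last p \<in> A - B then p @ [b, a] else p @ [a, b])"
  have sp: "set p = (A - B - {a}) \<union> (B - A - {b})" "distinct p"
    and alt: "successively (alt_rel (A - B - {a}) (B - A - {b})) p"
    and cov: "\<And>D. D \<subseteq> (A - {a}) \<union> (B - {b}) \<Longrightarrow> D \<noteq> {} \<Longrightarrow> bd g D = {} \<Longrightarrow>
      \<not> successively (\<lambda>x y. \<not> (x \<in> D \<and> y \<in> D)) p"
    using p unfolding alt_cover_path_def s by auto
  have sq: "set q = sym_diff A B" "distinct q" using sp ab False by (auto simp: q_def)
  have alt': "successively (alt_rel (A - B) (B - A)) p"
    using alt by (rule successively_mono) (auto simp: alt_rel_def)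
  have last: "p \<noteq> [] \<Longrightarrow> last p \<in> sym_diff A B" using sp last_in_set by fastforce
  have altq: "successively (alt_rel (A - B) (B - A)) q"
    using alt' last ab unfolding q_def alt_rel_def by (auto simp: successively_append_iff)
  have "\<not> successively (\<lambda>x y. \<not> (x \<in> D \<and> y \<in> D)) q"
    if D: "D \<subseteq> A \<union> B" "D \<noteq> {}" "bd g D = {}" for D
  proof
    assume su: "successively (\<lambda>x y. \<not> (x \<in> D \<and> y \<in> D)) q"
    then have "\<not> (a \<in> D \<and> b \<in> D)" and sup: "successively (\<lambda>x y. \<not> (x \<in> D \<and> y \<in> D)) p"
      by (auto simp: q_def successively_append_iff split: if_splits)
    \<comment> \<open>Only \<open>a\<close> and \<open>b\<close> meet \<open>v\<close>: an even set
      contains both, and is covered by the new final pair, or neither, and is covered within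
      \<open>p\<close>.\<close>
    moreover have "a \<in> D \<longleftrightarrow> b \<in> D" using mem_bd_iff_two[OF u False D(1)] D(3) by auto
    ultimately have "D \<subseteq> (A - {a}) \<union> (B - {b})" using D by auto
    then show False using cov D sup by blast
  qed
  then have "alt_cover_path g A B q" unfolding alt_cover_path_def using sq altq by blast
  then show ?thesis by blast
qed

text \<open>A subset of \<open>A\<close> has a boundary avoiding \<open>v\<close> iff it contains
  both or neither of \<open>a\<close> and \<open>c\<close>; such sets correspond to subsets of
  \<open>A - {c}\<close> with merged edge \<open>a\<close>. Both new spans are thus the part of the
  old span that avoids \<open>v\<close>.\<close>

lemma equivalent_forests_suppress:
  assumes ef: "equivalent_forests g A B"
    and a: "{e\<in>A. v \<in> g e} = {a, c}" "a \<noteq> c" "a \<notin> B" and b: "{e\<in>B. v \<in> g e} = {b}"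
  shows "equivalent_forests (g(a := sym_diff (g a) (g c))) (A - {c}) (B - {b})"
proof -
  let ?h = "g(a := sym_diff (g a) (g c))"
  have fin: "finite A" "finite B" and two: "\<And>e. e \<in> A \<union> B \<Longrightarrow> card (g e) = 2"
    and injA: "inj_on (bd g) (Pow A)" and injB: "inj_on (bd g) (Pow B)"
    and span: "bd g ` Pow A = bd g ` Pow B"
    using ef unfolding equivalent_forests_def by auto
  have ac: "a \<in> A" "c \<in> A" "v \<in> g a" "v \<in> g c" using a by auto
  \<comment> \<open>Parallel edges \<open>a\<close>, \<open>c\<close> would form a cycle in
    \<open>A\<close>; excluding this gives the merged edge two distinct ends.\<close>
  have "g a \<noteq> g c" using inj_onD[OF injA, of "{a}" "{c}"] ac a by auto
  moreover obtain x y where "g a = {x, y}" "x \<noteq> y" using two[of a] ac by (auto simp: card_2_iff)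
  moreover obtain z w where "g c = {z, w}" "z \<noteq> w" using two[of c] ac by (auto simp: card_2_iff)
  ultimately obtain s t where st: "g a = {v, s}" "g c = {v, t}" "v \<noteq> s" "v \<noteq> t" "s \<noteq> t"
    using ac by (metis doubleton_eq_iff insertE singletonD)
  then have "sym_diff (g a) (g c) = {s, t}" by auto
  then have h2: "\<forall>e\<in>(A - {c}) \<union> (B - {b}). card (?h e) = 2" using two st by auto
  have bdh: "bd ?h D = (if a \<in> D then bd g (insert c D) else bd g D)" if "D \<subseteq> A - {c}" for D
    using that fin a(2) finite_subset[of D A] by (intro bd_fun_upd_sum) auto
  \<comment> \<open>Here \<open>a \<notin> B\<close> matters: redefining the ends of
    \<open>a\<close> leaves \<open>B\<close> untouched.\<close>
  have hB: "bd ?h D = bd g D" if "D \<subseteq> B" for D using that a(3) by (intro bd_cong) auto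
  have img: "bd ?h ` Pow (A - {c}) = {X \<in> bd g ` Pow A. v \<notin> X}"
  proof (intro equalityI subsetI)
    fix X assume "X \<in> bd ?h ` Pow (A - {c})"
    then obtain D where D: "D \<subseteq> A - {c}" "X = bd ?h D" by auto
    let ?C = "if a \<in> D then insert c D else D"
    have C: "?C \<subseteq> A" "X = bd g ?C" using D ac bdh[of D] by auto
    moreover have "v \<notin> bd g ?C" using mem_bd_iff_two[OF a(1,2) C(1)] D by auto
    ultimately show "X \<in> {X \<in> bd g ` Pow A. v \<notin> X}" by blast
  next
    fix X assume "X \<in> {X \<in> bd g ` Pow A. v \<notin> X}"
    then obtain D where D: "D \<subseteq> A" "X = bd g D" "v \<notin> bd g D" by auto
    have ad: "a \<in> D \<longleftrightarrow> c \<in> D" using mem_bd_iff_two[OF a(1,2) D(1)] D by auto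
    have s: "D - {c} \<subseteq> A - {c}" using D by auto
    have "bd ?h (D - {c}) = X" using bdh[OF s] ad a(2) D(2)
      by (cases "c \<in> D") (auto simp: insert_absorb)
    then show "X \<in> bd ?h ` Pow (A - {c})" using s by blast
  qed
  have "bd ?h ` Pow (B - {b}) = bd g ` Pow (B - {b})" using hB by (intro image_cong) auto
  then have imgB: "bd ?h ` Pow (B - {b}) = {X \<in> bd g ` Pow B. v \<notin> X}"
    using bd_image_remove_unique[OF b] by simp
  have iA: "inj_on (bd ?h) (Pow (A - {c}))"
  proof (subst inj_on_bd_iff)
    show "finite (A - {c})" using fin by simp
    show "\<forall>D\<subseteq>A - {c}. bd ?h D = {} \<longrightarrow> D = {}"
    proof (intro allI impI)
      fix D assume D: "D \<subseteq> A - {c}" "bd ?h D = {}"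
      have R: "\<And>C. C \<subseteq> A \<Longrightarrow> bd g C = {} \<Longrightarrow> C = {}"
        using injA inj_on_bd_iff[OF fin(1), of g] by blast
      show "D = {}" using bdh[OF D(1)] D R[of D] R[of "insert c D"] ac by (auto split: if_splits)
    qed
  qed
  have iB: "inj_on (bd ?h) (Pow (B - {b}))"
    using injB hB by (auto simp: inj_on_def subset_Diff_insert)
  show ?thesis unfolding equivalent_forests_def using fin h2 iA iB img imgB span by auto
qed

lemma alt_cover_path_suppress:
  assumes p: "alt_cover_path (g(a := sym_diff (g a) (g c))) (A - {c}) (B - {b}) p"
    and fin: "finite A" "finite B"
    and a: "{e\<in>A. v \<in> g e} = {a, c}" "a \<noteq> c" "a \<notin> B" and b: "{e\<in>B. v \<in> g e} = {b}"
  shows "\<exists>q. alt_cover_path g A B q"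
proof -
  let ?h = "g(a := sym_diff (g a) (g c))"
  \<comment> \<open>Dropping \<open>c\<close> contracts an even set of the old graph to an even set
    of the merged graph.\<close>
  have bdh: "bd ?h (D - {c}) = bd g D"
    if "D \<subseteq> A \<union> B" "a \<in> D \<longleftrightarrow> c \<in> D" for D
  proof -
    have "finite D" using that fin finite_subset[of D "A \<union> B"] by auto
    then have "bd ?h (D - {c}) = (if a \<in> D - {c} then bd g (insert c (D - {c})) else bd g (D - {c}))"
      using a(2) by (intro bd_fun_upd_sum) auto
    then show ?thesis using that a(2) by (cases "c \<in> D") (auto simp: insert_absorb)
  qed
  have ab: "a \<in> A" "c \<in> A" "b \<in> B" "a \<noteq> b" using a b by auto
  show ?thesis
  proof (cases "b = c")
    \<comment> \<open>Here \<open>c\<close> is common to both forests, hence not on the path, and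
      \<open>p\<close> is kept unchanged.\<close>
    case True
    have u: "{e \<in> A \<union> B. v \<in> g e} = {a, c}" using a b True by blast
    have s: "(A - {c}) - (B - {b}) = A - B" "(B - {b}) - (A - {c}) = B - A" using ab True by auto
    have cov: "\<not> successively (\<lambda>x y. \<not> (x \<in> D \<and> y \<in> D)) p"
      if "D \<subseteq> (A - {c}) \<union> (B - {b})" "D \<noteq> {}" "bd ?h D = {}" for D
      using p that unfolding alt_cover_path_def by (elim conjE) simp
    have "\<not> successively (\<lambda>x y. \<not> (x \<in> D \<and> y \<in> D)) p"
      if D: "D \<subseteq> A \<union> B" "D \<noteq> {}" "bd g D = {}" for D
    proof
      assume su: "successively (\<lambda>x y. \<not> (x \<in> D \<and> y \<in> D)) p"
      have ad: "a \<in> D \<longleftrightarrow> c \<in> D" using mem_bd_iff_two[OF u a(2) D(1)] D by auto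
      have "D - {c} \<noteq> {}" using ad a(2) D(2) by auto
      moreover have "D - {c} \<subseteq> (A - {c}) \<union> (B - {b})" using D True by auto
      moreover have "successively (\<lambda>x y. \<not> (x \<in> D - {c} \<and> y \<in> D - {c})) p"
        using su by (rule successively_mono) auto
      moreover have "bd ?h (D - {c}) = {}" using bdh[OF D(1) ad] D(3) by simp
      ultimately show False using cov by blast
    qed
    moreover have "distinct p" "set p = sym_diff A B" "successively (alt_rel (A - B) (B - A)) p"
      using p unfolding alt_cover_path_def s by simp_all
    ultimately have "alt_cover_path g A B p" unfolding alt_cover_path_def by simp
    then show ?thesis by blast
  next
    case False
    have nb: "b \<notin> A" "c \<notin> B" using a b False ab by auto
    have u: "{e \<in> A \<union> B. v \<in> g e} = {a, b, c}" using a b by blast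
    have dis: "distinct [a, b, c]" using ab a False by auto
    have s: "(A - {c}) - (B - {b}) = A - B - {c}" "(B - {b}) - (A - {c}) = B - A - {b}"
      using ab nb by auto
    have sp: "set p = (A - B - {c}) \<union> (B - A - {b})" "distinct p"
      and alt: "successively (alt_rel (A - B - {c}) (B - A - {b})) p"
      and cov: "\<And>D. D \<subseteq> (A - {c}) \<union> (B - {b}) \<Longrightarrow> D \<noteq> {} \<Longrightarrow> bd ?h D = {} \<Longrightarrow>
        \<not> successively (\<lambda>x y. \<not> (x \<in> D \<and> y \<in> D)) p"
      using p unfolding alt_cover_path_def s by auto
    have "a \<in> set p" using sp ab a by auto
    then obtain xs ys where xy: "p = xs @ a # ys" by (meson split_list)
    define q where "q = xs @ [a, b, c] @ ys"
    have "set q = set p \<union> {b, c}" using xy by (auto simp: q_def)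
    then have sq: "set q = sym_diff A B" using sp ab nb by auto
    have dq: "distinct q" using sp dis ab nb unfolding xy q_def by auto
    have alt': "successively (alt_rel (A - B) (B - A)) p"
      using alt by (rule successively_mono) (auto simp: alt_rel_def)
    have altq: "successively (alt_rel (A - B) (B - A)) q"
      using alt' ab nb a(3) unfolding q_def xy
      by (auto simp: successively_append_iff successively_Cons alt_rel_def)
    have "\<not> successively (\<lambda>x y. \<not> (x \<in> D \<and> y \<in> D)) q"
      if D: "D \<subseteq> A \<union> B" "D \<noteq> {}" "bd g D = {}" for D
    proof
      assume su: "successively (\<lambda>x y. \<not> (x \<in> D \<and> y \<in> D)) q"
      then have "\<not> (a \<in> D \<and> b \<in> D)" "\<not> (b \<in> D \<and> c \<in> D)"
        by (auto simp: q_def successively_append_iff)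
      \<comment> \<open>Evenness at \<open>v\<close> leaves none or exactly two of \<open>a\<close>,
        \<open>b\<close>, \<open>c\<close> in \<open>D\<close>; the pairs with \<open>b\<close> are
        already ruled out as consecutive.\<close>
      moreover have "\<not> (((a \<in> D) \<noteq> (b \<in> D)) \<noteq> (c \<in> D))"
        using mem_bd_iff_three[OF u dis D(1)] D(3) by auto
      ultimately have ad: "a \<in> D \<longleftrightarrow> c \<in> D" and bD: "b \<notin> D" by auto
      have "D - {c} \<noteq> {}" using ad a(2) D(2) by auto
      moreover have "D - {c} \<subseteq> (A - {c}) \<union> (B - {b})" using D bD by auto
      \<comment> \<open>The element following \<open>a\<close> in \<open>p\<close> follows
        \<open>c\<close> in \<open>q\<close>, and \<open>D\<close> does not distinguish
        \<open>a\<close> from \<open>c\<close>.\<close>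
      moreover have "successively (\<lambda>x y. \<not> (x \<in> D \<and> y \<in> D)) p"
        using su ad unfolding q_def xy by (auto simp: successively_append_iff successively_Cons)
      then have "successively (\<lambda>x y. \<not> (x \<in> D - {c} \<and> y \<in> D - {c})) p"
        by (rule successively_mono) auto
      ultimately show False using cov[of "D - {c}"] bdh[OF D(1) ad] D(3) by blast
    qed
    then have "alt_cover_path g A B q" unfolding alt_cover_path_def using sq dq altq by blast
    then show ?thesis by blast
  qed
qed

lemma ex_alt_cover_path:
  "equivalent_forests g A B \<Longrightarrow> \<exists>p. alt_cover_path g A B p"
proof (induction "card A + card B" arbitrary: g A B rule: less_induct)
  case less
  have fin: "finite A" "finite B" using less.prems unfolding equivalent_forests_def by auto
  \<comment> \<open>Stated for a pair \<open>X\<close>, \<open>Y\<close> so that it serves degrees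
    (2,1) and, with the forests exchanged, (1,2).\<close>
  have suppress: "\<exists>p. alt_cover_path g X Y p"
    if ef: "equivalent_forests g X Y" and sz: "card X + card Y = card A + card B"
      and X: "card {e\<in>X. v \<in> g e} = 2" and Y: "card {e\<in>Y. v \<in> g e} = 1" for X Y v
  proof -
    have finXY: "finite X" "finite Y" using ef unfolding equivalent_forests_def by auto
    obtain b where b: "{e\<in>Y. v \<in> g e} = {b}" using Y by (auto simp: card_1_singleton_iff)
    obtain a' c' where ac': "{e\<in>X. v \<in> g e} = {a', c'}" "a' \<noteq> c'" using X by (auto simp: card_2_iff)
    \<comment> \<open>At most one of the two edges lies in \<open>Y\<close>, whose only edge at
      \<open>v\<close> is \<open>b\<close>; the names are chosen so that \<open>a\<close> is outside
      \<open>Y\<close>.\<close>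
    have mem: "v \<in> g a'" "v \<in> g c'" using ac' by auto
    obtain a c where ac: "{e\<in>X. v \<in> g e} = {a, c}" "a \<noteq> c" "a \<notin> Y"
    proof (cases "a' \<in> Y")
      case True
      then have "a' \<in> {e\<in>Y. v \<in> g e}" using mem by simp
      moreover have "c' \<notin> {e\<in>Y. v \<in> g e}" using calculation ac'(2) unfolding b by auto
      ultimately have "c' \<notin> Y" using mem by simp
      then show ?thesis using that[of c' a'] ac' by auto
    next
      case False
      then show ?thesis using that[of a' c'] ac' by auto
    qed
    have "c \<in> X" "b \<in> Y" using ac b by auto
    then have "card (X - {c}) + card (Y - {b}) < card A + card B"
      using sz finXY card_Diff1_less[of X c] card_Diff1_less[of Y b] by linarith
    from less.hyps[OF this equivalent_forests_suppress[OF ef ac b]]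
    show ?thesis using alt_cover_path_suppress[OF _ finXY ac b] by blast
  qed
  show ?case
  proof (cases "A = {}")
    case True
    then have "bd g ` Pow B = {{}}" using less.prems unfolding equivalent_forests_def by auto
    \<comment> \<open>A trivial span forces \<open>B\<close> to be empty by injectivity, which
      leaves the empty path.\<close>
    then have "bd g B = {}" by auto
    then have "B = {}" using less.prems inj_on_bd_iff[OF fin(2), of g]
      unfolding equivalent_forests_def by simp
    then have "alt_cover_path g A B []" using True unfolding alt_cover_path_def by auto
    then show ?thesis by blast
  next
    case False
    then obtain v where v: "{e\<in>A. v \<in> g e} \<noteq> {}" "{e\<in>B. v \<in> g e} \<noteq> {}"
      "card {e\<in>A. v \<in> g e} + card {e\<in>B. v \<in> g e} \<le> 3"
      using low_degree_vertex[OF less.prems] by blast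
    have "card {e\<in>A. v \<in> g e} > 0" "card {e\<in>B. v \<in> g e} > 0"
      using v fin by (auto simp: card_gt_0_iff)
    then consider "card {e\<in>A. v \<in> g e} = 1" "card {e\<in>B. v \<in> g e} = 1"
      | "card {e\<in>A. v \<in> g e} = 2" "card {e\<in>B. v \<in> g e} = 1"
      | "card {e\<in>B. v \<in> g e} = 2" "card {e\<in>A. v \<in> g e} = 1"
      using v(3) by linarith
    then show ?thesis
    proof cases
      case 1
      then obtain a b where a: "{e\<in>A. v \<in> g e} = {a}" and b: "{e\<in>B. v \<in> g e} = {b}"
        by (auto simp: card_1_singleton_iff)
      then have "a \<in> A" "b \<in> B" by auto
      then have "card (A - {a}) + card (B - {b}) < card A + card B"
        using fin card_Diff1_less[of A a] card_Diff1_less[of B b] by linarith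
      from less.hyps[OF this equivalent_forests_remove_leaf[OF less.prems a b]]
      show ?thesis using alt_cover_path_add_leaf[OF _ a b] by blast
    next
      case 2
      then show ?thesis using suppress[OF less.prems] by blast
    next
      case 3
      then obtain p where "alt_cover_path g B A p"
        using suppress[OF equivalent_forests_commute[OF less.prems]] by auto
      then show ?thesis using alt_cover_path_commute by blast
    qed
  qed
qed

section \<open>Cycles and even edge sets\<close>

text \<open>Telescoping: the first \<open>k\<close> edges have boundary \<open>vs ! 0\<close> plus
  \<open>vs ! k\<close>, and the closing edge cancels what remains.\<close>

lemma bd_cycle:
  assumes cyc: "is_cycle V F g vs es" and two: "\<And>e. e \<in> set es \<Longrightarrow> card (g e) = 2"
  shows "bd g (set es) = {}"
proof -
  define n where "n = length es"
  have n: "length vs = n" "length es = n" "n > 0" "distinct vs" "distinct es"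
    and ends: "\<And>i. i < n \<Longrightarrow> g (es ! i) = {vs ! i, vs ! (Suc i mod n)}"
    using cyc unfolding is_cycle_def n_def by auto
  have bd_take: "bd g (set (take k es)) = sym_diff {vs ! 0} {vs ! k}" if "k < n" for k
    using that
  proof (induction k)
    case 0
    then show ?case by simp
  next
    case (Suc k)
    have nm: "es ! k \<notin> set (take k es)"
      using n Suc.prems by (auto simp: in_set_conv_nth nth_eq_iff_index_eq)
    have "set (take (Suc k) es) = insert (es ! k) (set (take k es))"
      using Suc.prems n by (simp add: take_Suc_conv_app_nth)
    then have "bd g (set (take (Suc k) es)) = sym_diff (bd g (set (take k es))) (g (es ! k))"
      using bd_insert[OF _ nm, of g] by simp
    also have "\<dots> = sym_diff (sym_diff {vs ! 0} {vs ! k}) {vs ! k, vs ! Suc k}"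
      using Suc ends[of k] by simp
    also have "\<dots> = sym_diff {vs ! 0} {vs ! Suc k}"
      using n Suc.prems nth_eq_iff_index_eq[of vs k "Suc k"] by auto
    finally show ?case .
  qed
  obtain m where m: "n = Suc m" using n by (cases n) auto
  have nm: "es ! m \<notin> set (take m es)"
    using n m by (auto simp: in_set_conv_nth nth_eq_iff_index_eq)
  have e: "g (es ! m) = {vs ! m, vs ! 0}" using ends[of m] m by simp
  \<comment> \<open>This excludes the cycle of length 1, where the closing edge would be a
    loop.\<close>
  have "card (g (es ! m)) = 2" using two n m by simp
  then have "vs ! m \<noteq> vs ! 0" using e by auto
  have "es = take m es @ [es ! m]" using n m by (metis lessI order_refl take_Suc_conv_app_nth take_all)
  then have "set es = insert (es ! m) (set (take m es))"
    by (metis Un_insert_right list.set(1,2) set_append sup_bot_right)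
  then have "bd g (set es) = sym_diff (bd g (set (take m es))) (g (es ! m))"
    using bd_insert[OF _ nm, of g] by simp
  also have "\<dots> = {}" using bd_take[of m] m e \<open>vs ! m \<noteq> vs ! 0\<close> by auto
  finally show ?thesis .
qed

text \<open>A simple path in an edge set of minimum degree at least two either extends at its front or
  a second edge at its front vertex closes a cycle.\<close>

lemma ex_cycle_of_min_degree:
  assumes fin: "finite D" and ne: "D \<noteq> {}" and two: "\<And>e. e \<in> D \<Longrightarrow> card (g e) = 2"
    and V: "\<And>e. e \<in> D \<Longrightarrow> g e \<subseteq> V" and "D \<subseteq> F"
    and deg: "\<And>e v. e \<in> D \<Longrightarrow> v \<in> g e \<Longrightarrow> \<exists>e'\<in>D. e' \<noteq> e \<and> v \<in> g e'"
  shows "\<exists>vs es. is_cycle V F g vs es \<and> set es \<subseteq> D"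
proof (rule ccontr)
  assume nc: "\<not> ?thesis"
  \<comment> \<open>Open simple paths with at least one edge; they have one vertex more than
    edges.\<close>
  define P where "P = (\<lambda>vs es. length vs = Suc (length es) \<and> distinct vs \<and> distinct es \<and>
    set es \<subseteq> D \<and> es \<noteq> [] \<and> (\<forall>i<length es. g (es ! i) = {vs ! i, vs ! Suc i}))"
  have "\<exists>vs es. P vs es \<and> length es = Suc n" for n
  proof (induction n)
    case 0
    obtain e where e: "e \<in> D" using ne by auto
    then obtain x y where "g e = {x, y}" "x \<noteq> y" using two[OF e] by (auto simp: card_2_iff)
    then have "P [x, y] [e]" using e unfolding P_def by auto
    then show ?case by force
  next
    case (Suc n)
    then obtain vs es where P: "P vs es" and len: "length es = Suc n" by blast
    have lv: "length vs = Suc (length es)" and dv: "distinct vs" and de: "distinct es"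
      and sub: "set es \<subseteq> D" and ends: "\<And>i. i < length es \<Longrightarrow> g (es ! i) = {vs ! i, vs ! Suc i}"
      using P unfolding P_def by auto
    let ?v = "vs ! 0"
    have "es ! 0 \<in> D" using sub len nth_mem[of 0 es] by auto
    moreover have "?v \<in> g (es ! 0)" using ends[of 0] len by simp
    ultimately obtain e where e: "e \<in> D" "e \<noteq> es ! 0" "?v \<in> g e" using deg by blast
    obtain x where x: "g e = {?v, x}" "x \<noteq> ?v"
      using two[OF e(1)] e(3) by (metis card_2_iff doubleton_eq_iff insertE singletonD)
    have e_first: "e \<notin> set es"
    proof
      assume "e \<in> set es"
      then obtain j where j: "j < length es" "es ! j = e" by (auto simp: in_set_conv_nth)
      then have "?v = vs ! j \<or> ?v = vs ! Suc j" using ends[of j] e(3) by auto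
      then have "j = 0" using dv lv j nth_eq_iff_index_eq[of vs 0] by auto
      then show False using j e by simp
    qed
    have "x \<notin> set vs"
    proof
      assume "x \<in> set vs"
      then obtain k where k: "k < length vs" "vs ! k = x" by (auto simp: in_set_conv_nth)
      \<comment> \<open>The initial segment from \<open>vs ! 0\<close> to \<open>x = vs ! k\<close>
        is closed by \<open>e\<close>; \<open>k = 1\<close> gives a pair of parallel edges.\<close>
      let ?vs = "take (Suc k) vs" and ?es = "take k es @ [e]"
      have l: "length ?es = Suc k" "length ?vs = Suc k" using k lv by auto
      have "distinct ?es" using de e_first by (auto dest: in_set_takeD)
      moreover have sD: "set ?es \<subseteq> D" using sub e by (auto dest: in_set_takeD)
      moreover have E: "g (?es ! i) = {?vs ! i, ?vs ! (Suc i mod length ?es)}" if "i < length ?es" for i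
      proof (cases "i = k")
        case True
        then show ?thesis using l k lv x by (auto simp: nth_append)
      next
        case False
        then have "i < k" using that l by simp
        then show ?thesis using l k lv ends[of i] by (simp add: nth_append)
      qed
      moreover have "set ?vs \<subseteq> V"
      proof
        fix u assume "u \<in> set ?vs"
        then obtain i where i: "i < length ?es" "?vs ! i = u" using l by (metis in_set_conv_nth)
        then have "?es ! i \<in> D" using sD nth_mem by blast
        then show "u \<in> V" using E[OF i(1)] V i by blast
      qed
      ultimately have "is_cycle V F g ?vs ?es"
        unfolding is_cycle_def using l dv \<open>D \<subseteq> F\<close> by auto
      then show False using nc sD by blast
    qed
    have "g ((e # es) ! i) = {(x # vs) ! i, (x # vs) ! Suc i}" if "i < length (e # es)" for i
      using that x ends by (cases i) auto
    then have "P (x # vs) (e # es)"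
      unfolding P_def using lv dv de sub e e_first \<open>x \<notin> set vs\<close> by auto
    then show ?case using len by (metis length_Cons)
  qed
  \<comment> \<open>Paths of every positive length exist, yet \<open>D\<close> has only
    \<open>card D\<close> edges.\<close>
  from this[of "card D"] obtain es where "distinct es" "set es \<subseteq> D" "length es = Suc (card D)"
    unfolding P_def by blast
  then show False using card_mono[OF fin, of "set es"] distinct_card[of es] by simp
qed

text \<open>A vertex met by exactly one edge of \<open>D\<close> would have odd degree.\<close>

lemma ex_cycle_of_bd_empty:
  assumes fin: "finite D" and ne: "D \<noteq> {}" and two: "\<And>e. e \<in> D \<Longrightarrow> card (g e) = 2"
    and V: "\<And>e. e \<in> D \<Longrightarrow> g e \<subseteq> V" and F: "D \<subseteq> F" and bd: "bd g D = {}"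
  shows "\<exists>vs es. is_cycle V F g vs es \<and> set es \<subseteq> D"
proof (rule ex_cycle_of_min_degree[OF fin ne two V F])
  fix e v assume e: "e \<in> D" "v \<in> g e"
  show "\<exists>e'\<in>D. e' \<noteq> e \<and> v \<in> g e'"
  proof (rule ccontr)
    assume "\<not> ?thesis"
    then have "{e\<in>D. v \<in> g e} = {e}" using e by auto
    then show False using mem_bd_iff_unique[of D v g e D] e bd by auto
  qed
qed

section \<open>Graphic matroids\<close>

lemma bd_image:
  assumes "inj_on f D"
  shows "bd g (f ` D) = bd (g \<circ> f) D"
proof -
  have "card {e \<in> f ` D. v \<in> g e} = card {e \<in> D. v \<in> (g \<circ> f) e}" for v
  proof -
    have "{e \<in> f ` D. v \<in> g e} = f ` {e \<in> D. v \<in> (g \<circ> f) e}" by auto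
    then show ?thesis using assms by (simp add: card_image inj_on_def)
  qed
  then show ?thesis unfolding bd_def by simp
qed

text \<open>The span of \<open>A\<close> is closed under symmetric difference, so it suffices to
  reach the single edges of \<open>B\<close>.\<close>

lemma bd_image_mono_of_generators:
  assumes fin: "finite A" "finite B" and gen: "\<And>e. e \<in> B \<Longrightarrow> g e \<in> bd g ` Pow A"
  shows "bd g ` Pow B \<subseteq> bd g ` Pow A"
proof -
  have "bd g D \<in> bd g ` Pow A" if "D \<subseteq> B" for D
    using finite_subset[OF that fin(2)] that
  proof (induction D)
    case empty
    then show ?case by (metis Pow_bottom bd_empty imageI)
  next
    case (insert e D)
    then obtain X Y where XY: "X \<subseteq> A" "bd g D = bd g X" "Y \<subseteq> A" "g e = bd g Y"
      using gen[of e] by auto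
    then have "bd g (insert e D) = bd g (sym_diff X Y)"
      using bd_insert[of D e g] insert bd_sym_diff[of X Y g] fin finite_subset by metis
    moreover have "sym_diff X Y \<subseteq> A" using XY by auto
    ultimately show ?case by blast
  qed
  then show ?thesis by auto
qed

theorem theorem14:
  fixes E :: "'a set" and indep :: "'a set \<Rightarrow> bool"
    and V :: "'v set" and F :: "'e set" and ends :: "'e \<Rightarrow> 'v set"
  assumes "graphic_matroid_via E indep V F ends"
  shows "property_P_plus E indep"
proof -
  interpret M: matroid E indep using assms unfolding graphic_matroid_via_def by simp
  interpret G: finite_multigraph V F ends using assms unfolding graphic_matroid_via_def by simp
  obtain f where f: "bij_betw f E F"
    and iso: "\<And>X. X \<subseteq> E \<Longrightarrow> indep X \<longleftrightarrow> cycle_matroid_indep V F ends (f ` X)"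
    using assms unfolding graphic_matroid_via_def matroid_isomorphic_def by auto
  \<comment> \<open>The graph is carried over to the matroid elements, which become its
    edges.\<close>
  define g where "g = ends \<circ> f"
  have injf: "inj_on f X" if "X \<subseteq> E" for X using f that inj_on_subset unfolding bij_betw_def by blast
  have fE: "f x \<in> F" if "x \<in> E" for x using f that bij_betwE by blast
  have two: "card (g e) = 2" if "indep {e}" for e
  proof (rule ccontr)
    assume n2: "card (g e) \<noteq> 2"
    have e: "e \<in> E" using M.indep_subset_carrier[OF that] by simp
    then have "card (g e) = 1" using G.card_ends[OF fE[OF e]] n2 by (auto simp: g_def)
    then obtain v where v: "ends (f e) = {v}" by (auto simp: g_def card_1_singleton_iff)
    then have "is_cycle V F ends [v] [f e]"
      using G.ends_subset[OF fE[OF e]] fE[OF e] unfolding is_cycle_def by auto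
    moreover have "set [f e] \<subseteq> f ` {e}" by simp
    ultimately have "\<not> cycle_matroid_indep V F ends (f ` {e})"
      unfolding cycle_matroid_indep_def by blast
    then show False using iso[of "{e}"] e that by auto
  qed
  \<comment> \<open>A dependent set without loops contains the preimage of a cycle, and this
    preimage is even.\<close>
  have even_sub: "\<exists>D\<subseteq>X. D \<noteq> {} \<and> bd g D = {}"
    if X: "X \<subseteq> E" "\<not> indep X" "\<And>e. e \<in> X \<Longrightarrow> indep {e}" for X
  proof -
    have "f ` X \<subseteq> F" using X fE by auto
    then obtain vs es where c: "is_cycle V F ends vs es" "set es \<subseteq> f ` X"
      using X iso[OF X(1)] unfolding cycle_matroid_indep_def by blast
    then obtain D where D: "D \<subseteq> X" "set es = f ` D" by (meson subset_imageE)
    have "bd ends (set es) = {}"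
      using c(1) by (rule bd_cycle) (use c(2) X(3) two in \<open>auto simp: g_def\<close>)
    then have "bd g D = {}" using bd_image[OF injf, of D ends] D X by (simp add: g_def)
    moreover have "D \<noteq> {}" using c(1) D unfolding is_cycle_def by auto
    ultimately show ?thesis using D by blast
  qed
  have no_even: "D = {}" if X: "indep X" "D \<subseteq> X" "bd g D = {}" for X D
  proof (rule ccontr)
    assume ne: "D \<noteq> {}"
    have XE: "X \<subseteq> E" using M.indep_subset_carrier X by auto
    have DE: "D \<subseteq> E" using XE X by auto
    have bdf: "bd ends (f ` D) = {}" using bd_image[OF injf[OF DE], of ends] X by (simp add: g_def)
    have "\<exists>vs es. is_cycle V F ends vs es \<and> set es \<subseteq> f ` D"
    proof (rule ex_cycle_of_bd_empty)
      show "finite (f ` D)" using DE M.finite_carrier finite_subset by blast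
      show "f ` D \<noteq> {}" using ne by simp
      show "card (ends e) = 2" if "e \<in> f ` D" for e
        using that two M.indep_mono[OF X(1)] X(2) by (auto simp: g_def)
      show "ends e \<subseteq> V" if "e \<in> f ` D" for e using that G.ends_subset fE DE by blast
      show "f ` D \<subseteq> F" using fE DE by auto
    qed (rule bdf)
    then obtain vs es where "is_cycle V F ends vs es" "set es \<subseteq> f ` D" by blast
    moreover have "f ` D \<subseteq> f ` X" using X(2) by auto
    ultimately have "\<not> cycle_matroid_indep V F ends (f ` X)"
      unfolding cycle_matroid_indep_def by (meson subset_trans)
    then show False using iso[OF XE] X by simp
  qed
  have generate: "g e \<in> bd g ` Pow A" if A: "basis E indep A" and e: "indep {e}" for A e
  proof (cases "e \<in> A")
    case True
    then show ?thesis using bd_singleton[of g e] by (metis Pow_iff empty_subsetI image_eqI insert_subset)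
  next
    case False
    have AE: "A \<subseteq> E" "indep A" using A unfolding basis_def by auto
    have eE: "e \<in> E" using M.indep_subset_carrier[OF e] by simp
    have "\<not> indep (insert e A)" using A False eE AE unfolding basis_def by auto
    moreover have "indep {x}" if "x \<in> insert e A" for x
      using that e M.indep_mono[OF AE(2), of "{x}"] by auto
    \<comment> \<open>\<open>D\<close> plays the part of the fundamental circuit of
      \<open>e\<close>: it contains \<open>e\<close>, and its other elements express
      \<open>g e\<close> through \<open>A\<close>.\<close>
    ultimately obtain D where D: "D \<subseteq> insert e A" "D \<noteq> {}" "bd g D = {}"
      using even_sub[of "insert e A"] eE AE by auto
    have "e \<in> D" using no_even[OF AE(2), of D] D by blast
    define C where "C = D - {e}"
    have C: "D = insert e C" "e \<notin> C" "C \<subseteq> A" using C_def D \<open>e \<in> D\<close> by auto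
    then have "finite C" using AE M.finite_carrier finite_subset by metis
    then have "sym_diff (bd g C) (g e) = {}" using bd_insert[of C e g] C D by simp
    then have "g e = bd g C" by auto
    then show ?thesis using C by blast
  qed
  show ?thesis unfolding property_P_plus_def
  proof (intro allI impI)
    fix A B assume "basis E indep A \<and> basis E indep B"
    then have A: "basis E indep A" and B: "basis E indep B" by auto
    have iA: "indep A" "A \<subseteq> E" and iB: "indep B" "B \<subseteq> E" using A B unfolding basis_def by auto
    have fin: "finite A" "finite B" using iA iB M.finite_carrier finite_subset by auto
    have single: "indep {e}" if "e \<in> A \<union> B" for e
      using that M.indep_mono[OF iA(1), of "{e}"] M.indep_mono[OF iB(1), of "{e}"] by auto
    have "bd g ` Pow B \<subseteq> bd g ` Pow A"
      using generate[OF A] single by (intro bd_image_mono_of_generators fin) simp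
    moreover have "bd g ` Pow A \<subseteq> bd g ` Pow B"
      using generate[OF B] single by (intro bd_image_mono_of_generators fin) simp
    moreover have "inj_on (bd g) (Pow A)" "inj_on (bd g) (Pow B)"
      unfolding inj_on_bd_iff[OF fin(1)] inj_on_bd_iff[OF fin(2)]
      using no_even[OF iA(1)] no_even[OF iB(1)] by simp_all
    ultimately have "equivalent_forests g A B"
      unfolding equivalent_forests_def using fin two single by simp
    then obtain p where p: "alt_cover_path g A B p" using ex_alt_cover_path by blast
    have "path_on (sym_diff A B) p" using p unfolding alt_cover_path_def path_on_def by auto
    moreover have "alternates (A - B) (B - A) p"
      using p unfolding alt_cover_path_def alternates_def successively_conv_nth alt_rel_def by auto
    moreover have "covers (path_edges p) (circuits_in E indep (A \<union> B))"
      unfolding covers_def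
    proof
      fix C assume "C \<in> circuits_in E indep (A \<union> B)"
      then have C: "C \<subseteq> E" "\<not> indep C" "C \<subseteq> A \<union> B" unfolding circuits_in_def by auto
      \<comment> \<open>A consecutive pair inside an even subset of the circuit also lies in the
        circuit.\<close>
      then obtain D where D: "D \<subseteq> C" "D \<noteq> {}" "bd g D = {}" using even_sub[of C] single by blast
      moreover have "D \<subseteq> A \<union> B" using D C by auto
      ultimately have "\<not> successively (\<lambda>x y. \<not> (x \<in> D \<and> y \<in> D)) p"
        using p unfolding alt_cover_path_def by (elim conjE) simp
      then obtain i where i: "Suc i < length p" "p ! i \<in> D" "p ! Suc i \<in> D"
        unfolding successively_conv_nth by auto
      show "\<exists>e\<in>path_edges p. e \<subseteq> C"
      proof (rule bexI)
        show "{p ! i, p ! Suc i} \<subseteq> C" using i D(1) by auto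
        show "{p ! i, p ! Suc i} \<in> path_edges p" using i(1) unfolding path_edges_def by auto
      qed
    qed
    ultimately show "\<exists>p. path_on (sym_diff A B) p \<and> alternates (A - B) (B - A) p \<and>
        covers (path_edges p) (circuits_in E indep (A \<union> B))" by blast
  qed
qed

end
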